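(* For any $f\in L^1(\mathbb{R}^N)$ there exists a unique $L^1$-solution of the nonlocal Stefan problem $$\partial_t u=J*v-v,\quad v=(u-1)_+\ \text{ in }\mathbb{R}^N\times(0,\infty),\qquad u(\cdot,0)=f .$$
   Context: Standing assumptions: $J:\mathbb{R}^N\to\mathbb{R}$ is continuous, compactly supported, radially symmetric, and $\int_{\mathbb{R}^N}J=1$. Here $*$ is convolution in the space variable and $s_+=\max\{s,0\}$. Definition ($L^1$-solution). For $f\in L^1(\mathbb{R}^N)$, an $L^1$-solution is a function $u\in C([0,\infty);L^1(\mathbb{R}^N))$ such that the equation holds in the sense of distributions, or equivalently, for every $t>0$, $u(t)\in L^1(\mathbb{R}^N)$ and $$u(t)=f+\int_0^t\big(J*v(s)-v(s)\big)\,ds,\qquad v=(u-1)_+\quad\text{a.e.}$$ *)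

theory Defs
  imports "HOL-Analysis.Analysis"
begin

definition L1_rel :: "('a::euclidean_space \<Rightarrow> real) \<Rightarrow> ('a \<Rightarrow> real) \<Rightarrow> bool" where
  "L1_rel f g \<longleftrightarrow>
     integrable lebesgue f \<and> integrable lebesgue g \<and> (AE x in lebesgue. f x = g x)"

lemma part_equivp_L1_rel: "part_equivp L1_rel"
proof (rule part_equivpI)
  show "\<exists>f::'a \<Rightarrow> real. L1_rel f f"
    by (rule exI[of _ "\<lambda>_. 0"]) (simp add: L1_rel_def)
  show "symp (L1_rel :: ('a \<Rightarrow> real) \<Rightarrow> _)"
    by (auto simp: symp_def L1_rel_def)
  show "transp (L1_rel :: ('a \<Rightarrow> real) \<Rightarrow> _)"
  proof (rule transpI)
    fix f g h :: "'a \<Rightarrow> real"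
    assume a: "L1_rel f g" "L1_rel g h"
    then have "AE x in lebesgue. f x = g x" "AE x in lebesgue. g x = h x"
      by (auto simp: L1_rel_def)
    then have "AE x in lebesgue. f x = h x" by eventually_elim simp
    with a show "L1_rel f h" by (simp add: L1_rel_def)
  qed
qed

quotient_type (overloaded) 'a L1 = "'a::euclidean_space \<Rightarrow> real" / partial: L1_rel
  by (rule part_equivp_L1_rel)

lemma L1_rel_integral_abs:
  assumes "L1_rel f g"
  shows "(\<integral>x. \<bar>f x\<bar> \<partial>lebesgue) = (\<integral>x. \<bar>g x\<bar> \<partial>lebesgue)"
proof (rule integral_cong_AE)
  show "(\<lambda>x. \<bar>f x\<bar>) \<in> borel_measurable lebesgue" "(\<lambda>x. \<bar>g x\<bar>) \<in> borel_measurable lebesgue"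
    using assms by (auto simp: L1_rel_def)
  show "AE x in lebesgue. \<bar>f x\<bar> = \<bar>g x\<bar>"
    using assms by (auto simp: L1_rel_def)
qed

instantiation L1 :: (euclidean_space) real_normed_vector
begin

lift_definition zero_L1 :: "'a L1" is "\<lambda>_. 0"
  by (simp add: L1_rel_def)

lift_definition plus_L1 :: "'a L1 \<Rightarrow> 'a L1 \<Rightarrow> 'a L1" is "\<lambda>f g x. f x + g x"
  unfolding L1_rel_def by auto

lift_definition uminus_L1 :: "'a L1 \<Rightarrow> 'a L1" is "\<lambda>f x. - f x"
  unfolding L1_rel_def by auto

lift_definition minus_L1 :: "'a L1 \<Rightarrow> 'a L1 \<Rightarrow> 'a L1" is "\<lambda>f g x. f x - g x"
  unfolding L1_rel_def by auto

lift_definition scaleR_L1 :: "real \<Rightarrow> 'a L1 \<Rightarrow> 'a L1" is "\<lambda>c f x. c * f x"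
  unfolding L1_rel_def by auto

lift_definition norm_L1 :: "'a L1 \<Rightarrow> real" is "\<lambda>f. \<integral>x. \<bar>f x\<bar> \<partial>lebesgue"
  by (rule L1_rel_integral_abs)

definition dist_L1 :: "'a L1 \<Rightarrow> 'a L1 \<Rightarrow> real" where
  "dist_L1 f g = norm (f - g)"

definition sgn_L1 :: "'a L1 \<Rightarrow> 'a L1" where
  "sgn_L1 f = inverse (norm f) *\<^sub>R f"

definition uniformity_L1 :: "('a L1 \<times> 'a L1) filter" where
  "uniformity_L1 = (INF e\<in>{0 <..}. principal {(f, g). dist f g < e})"

definition open_L1 :: "'a L1 set \<Rightarrow> bool" where
  "open_L1 U \<longleftrightarrow> (\<forall>f\<in>U. eventually (\<lambda>(f', g). f' = f \<longrightarrow> g \<in> U) uniformity)"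

instance
proof
  fix f g h :: "'a L1" and a b :: real and U :: "'a L1 set"
  show "f + g + h = f + (g + h)"
    by transfer (auto simp: L1_rel_def add.assoc)
  show "f + g = g + f"
    by transfer (auto simp: L1_rel_def add.commute)
  show "0 + f = f"
    by transfer (auto simp: L1_rel_def)
  show "- f + f = 0"
    by transfer (auto simp: L1_rel_def)
  show "f - g = f + - g"
    by transfer (auto simp: L1_rel_def)
  show "a *\<^sub>R (f + g) = a *\<^sub>R f + a *\<^sub>R g"
    by transfer (auto simp: L1_rel_def distrib_left)
  show "(a + b) *\<^sub>R f = a *\<^sub>R f + b *\<^sub>R f"
    by transfer (auto simp: L1_rel_def distrib_right)
  show "a *\<^sub>R b *\<^sub>R f = (a * b) *\<^sub>R f"
    by transfer (auto simp: L1_rel_def mult.assoc)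
  show "1 *\<^sub>R f = f"
    by transfer (auto simp: L1_rel_def)
  show "dist f g = norm (f - g)"
    by (rule dist_L1_def)
  show "sgn f = inverse (norm f) *\<^sub>R f"
    by (rule sgn_L1_def)
  show "uniformity = (INF e\<in>{0 <..}. principal {(f::'a L1, g). dist f g < e})"
    by (rule uniformity_L1_def)
  show "open U \<longleftrightarrow> (\<forall>f\<in>U. eventually (\<lambda>(f', g). f' = f \<longrightarrow> g \<in> U) uniformity)"
    by (rule open_L1_def)
  show "norm f = 0 \<longleftrightarrow> f = 0"
  proof transfer
    fix f :: "'a \<Rightarrow> real"
    assume "L1_rel f f"
    then have f: "integrable lebesgue f" by (simp add: L1_rel_def)
    then have "(\<integral>x. \<bar>f x\<bar> \<partial>lebesgue) = 0 \<longleftrightarrow> (AE x in lebesgue. \<bar>f x\<bar> = 0)"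
      by (intro integral_nonneg_eq_0_iff_AE) auto
    with f show "(\<integral>x. \<bar>f x\<bar> \<partial>lebesgue) = 0 \<longleftrightarrow> L1_rel f (\<lambda>_. 0)"
      by (simp add: L1_rel_def)
  qed
  show "norm (f + g) \<le> norm f + norm g"
  proof transfer
    fix f g :: "'a \<Rightarrow> real"
    assume "L1_rel f f" "L1_rel g g"
    then have fg: "integrable lebesgue f" "integrable lebesgue g" by (auto simp: L1_rel_def)
    then have "(\<integral>x. \<bar>f x + g x\<bar> \<partial>lebesgue) \<le> (\<integral>x. \<bar>f x\<bar> + \<bar>g x\<bar> \<partial>lebesgue)"
      by (intro integral_mono) auto
    also have "\<dots> = (\<integral>x. \<bar>f x\<bar> \<partial>lebesgue) + (\<integral>x. \<bar>g x\<bar> \<partial>lebesgue)"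
      using fg by simp
    finally show "(\<integral>x. \<bar>f x + g x\<bar> \<partial>lebesgue)
        \<le> (\<integral>x. \<bar>f x\<bar> \<partial>lebesgue) + (\<integral>x. \<bar>g x\<bar> \<partial>lebesgue)" .
  qed
  show "norm (a *\<^sub>R f) = \<bar>a\<bar> * norm f"
    by transfer (simp add: abs_mult)
qed

end

lift_definition excess :: "'a::euclidean_space L1 \<Rightarrow> 'a L1" is "\<lambda>u x. max (u x - 1) 0"
proof -
  have *: "integrable lebesgue (\<lambda>x. max (u x - 1) 0)" if "integrable lebesgue u"
    for u :: "'a \<Rightarrow> real"
    using that by (rule Bochner_Integration.integrable_bound) (use that in auto)
  show "L1_rel (\<lambda>x. max (u x - 1) 0) (\<lambda>x. max (w x - 1) 0)" if "L1_rel u w"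
    for u w :: "'a \<Rightarrow> real"
    using that *[of u] *[of w] unfolding L1_rel_def by auto
qed

definition convolution :: "('a::euclidean_space \<Rightarrow> real) \<Rightarrow> ('a \<Rightarrow> real) \<Rightarrow> 'a \<Rightarrow> real" where
  "convolution J g x = (\<integral>y. J (x - y) * g y \<partial>lebesgue)"

text \<open>The term \<open>rep_L1 g\<close> is an arbitrary representative of \<open>g\<close>, and \<open>abs_L1\<close> is meaningful only
  on integrable functions. For continuous, compactly supported \<open>J\<close> neither matters:
  see \<open>L1_rel_convolution\<close> and \<open>L1_conv_abs_L1\<close> below.\<close>

definition L1_conv :: "('a::euclidean_space \<Rightarrow> real) \<Rightarrow> 'a L1 \<Rightarrow> 'a L1" where
  "L1_conv J g = abs_L1 (convolution J (rep_L1 g))"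

lemma L1_rel_convolution:
  fixes J :: "'a::euclidean_space \<Rightarrow> real"
  assumes cont: "continuous_on UNIV J" and supp: "compact (closure {x. J x \<noteq> 0})"
    and gh: "L1_rel g h"
  shows "L1_rel (convolution J g) (convolution J h)"
proof -
  have Jm[measurable]: "J \<in> borel_measurable borel"
    using cont by (rule borel_measurable_continuous_onI)
  have J: "integrable lborel J"
  proof -
    let ?K = "closure {x. J x \<noteq> 0}"
    have "set_integrable lborel ?K J"
      unfolding set_integrable_def
      by (rule borel_integrable_compact[OF supp]) (rule continuous_on_subset[OF cont], simp)
    moreover have "(\<lambda>x. indicator ?K x *\<^sub>R J x) = J"
      using closure_subset[of "{x. J x \<noteq> 0}"] by (auto simp: indicator_def fun_eq_iff)
    ultimately show ?thesis by (simp add: set_integrable_def)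
  qed
  have g: "integrable lebesgue g" and h: "integrable lebesgue h"
    and gh': "AE x in lebesgue. g x = h x"
    using gh by (auto simp: L1_rel_def)
  have gm: "g \<in> borel_measurable lebesgue" and hm: "h \<in> borel_measurable lebesgue"
    using g h by auto
  have J_leb: "(\<lambda>y. J (x - y)) \<in> borel_measurable lebesgue" for x
    by (rule measurable_completion) measurable
  have eq: "convolution J p = convolution J q"
    if pm: "p \<in> borel_measurable lebesgue" and qm: "q \<in> borel_measurable lebesgue"
      and pq: "AE x in lebesgue. p x = q x" for p q
  proof
    fix x
    show "convolution J p x = convolution J q x"
      unfolding convolution_def
    proof (rule integral_cong_AE)
      show "(\<lambda>y. J (x - y) * p y) \<in> borel_measurable lebesgue"
        using J_leb pm by (rule borel_measurable_times)
      show "(\<lambda>y. J (x - y) * q y) \<in> borel_measurable lebesgue"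
        using J_leb qm by (rule borel_measurable_times)
      show "AE y in lebesgue. J (x - y) * p y = J (x - y) * q y"
        using pq by auto
    qed
  qed
  obtain b where bm[measurable]: "b \<in> borel_measurable lborel"
    and gb: "AE x in lborel. g x = b x"
    using completion_ex_borel_measurable_real[OF gm] by blast
  have bm_leb: "b \<in> borel_measurable lebesgue"
    using bm by (rule measurable_completion)
  have gb': "AE x in lebesgue. g x = b x"
    using gb by (rule AE_completion)
  have b: "integrable lborel b"
  proof -
    have "integrable lebesgue b"
      using g integrable_cong_AE[OF gm bm_leb gb'] by simp
    then show ?thesis using bm by (simp add: integrable_completion)
  qed
  have J_shift: "integrable lborel (\<lambda>x. J (x - y))" for y
  proof -
    have "integrable (distr lborel borel ((+) (- y))) J"
      using J by (simp add: lborel_distr_plus)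
    then have "integrable lborel (\<lambda>x. J (- y + x))"
      by (simp add: integrable_distr_eq)
    then show ?thesis by simp
  qed
  have norm_shift: "(\<integral>x. \<bar>J (x - y)\<bar> \<partial>lborel) = (\<integral>x. \<bar>J x\<bar> \<partial>lborel)" for y
  proof -
    have "(\<integral>x. \<bar>J x\<bar> \<partial>lborel) = (\<integral>x. \<bar>J x\<bar> \<partial>distr lborel borel ((+) (- y)))"
      by (simp add: lborel_distr_plus)
    also have "\<dots> = (\<integral>x. \<bar>J (- y + x)\<bar> \<partial>lborel)"
      by (rule integral_distr) measurable
    finally show ?thesis by simp
  qed
  have "integrable (lborel \<Otimes>\<^sub>M lborel) (\<lambda>(y, x). J (x - y) * b y)"
  proof (rule lborel_pair.Fubini_integrable)
    show "(\<lambda>(y, x). J (x - y) * b y) \<in> borel_measurable (lborel \<Otimes>\<^sub>M lborel)"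
      by measurable
    show "integrable lborel (\<lambda>y. \<integral>x. norm (case (y, x) of (y, x) \<Rightarrow> J (x - y) * b y) \<partial>lborel)"
      using b by (simp add: abs_mult norm_shift)
    show "AE y in lborel. integrable lborel (\<lambda>x. case (y, x) of (y, x) \<Rightarrow> J (x - y) * b y)"
      using J_shift by simp
  qed
  then have "integrable (lborel \<Otimes>\<^sub>M lborel) (\<lambda>(x, y). J (x - y) * b y)"
    by (subst lborel_pair.integrable_product_swap_iff[symmetric]) (simp add: split_def)
  from lborel_pair.integrable_fst'[OF this]
  have "integrable lborel (\<lambda>x. \<integral>y. J (x - y) * b y \<partial>lborel)"
    by simp
  also have "(\<lambda>x. \<integral>y. J (x - y) * b y \<partial>lborel) = convolution J b"
    unfolding convolution_def by (rule ext, rule integral_completion[symmetric]) measurable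
  finally have "integrable lborel (convolution J b)" .
  then have "integrable lebesgue (convolution J b)"
    by (subst integrable_completion) auto
  then show ?thesis
    using eq[OF gm bm_leb gb'] eq[OF gm hm gh'] by (simp add: L1_rel_def)
qed

lemma L1_conv_abs_L1:
  fixes J :: "'a::euclidean_space \<Rightarrow> real"
  assumes "continuous_on UNIV J" "compact (closure {x. J x \<noteq> 0})" "integrable lebesgue g"
  shows "L1_conv J (abs_L1 g) = abs_L1 (convolution J g)"
proof -
  have "L1_rel (rep_L1 (abs_L1 g)) g"
    by (rule Quotient3_rep_abs[OF Quotient3_L1]) (use assms in \<open>simp add: L1_rel_def\<close>)
  from L1_rel_convolution[OF assms(1,2) this] show ?thesis
    unfolding L1_conv_def by (rule Quotient3_rel_abs[OF Quotient3_L1])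
qed

text \<open>The time integral is an integral of a function with values in the normed space \<open>'a L1\<close>.
  The Henstock--Kurzweil integral is used because the Bochner integral of the library demands
  further type class instances of \<open>'a L1\<close>; for the integrand here, which is continuous in \<open>s\<close> when
  \<open>u\<close> and \<open>J\<close> are, both agree with the Riemann integral.
  The values of \<open>u\<close> at negative times play no role, so solutions are unique only up to them.\<close>

definition L1_solution ::
  "('a::euclidean_space \<Rightarrow> real) \<Rightarrow> 'a L1 \<Rightarrow> (real \<Rightarrow> 'a L1) \<Rightarrow> bool" where
  "L1_solution J f u \<longleftrightarrow>
     continuous_on {0..} u \<and> u 0 = f \<and>
     (\<forall>t>0. ((\<lambda>s. L1_conv J (excess (u s)) - excess (u s)) has_integral (u t - f)) {0..t})"

end

theory Submission
  imports Defs
begin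

text \<open>Since \<open>u \<mapsto> (u - 1)\<^sub>+\<close> is a contraction of \<open>L\<^sup>1\<close> and convolution with \<open>J\<close> has operator norm at
  most \<open>\<parallel>J\<parallel>\<^sub>1\<close>, the problem is an ordinary differential equation \<open>u' = G u\<close> in the Banach space
  \<open>L\<^sup>1\<close> whose right-hand side is globally Lipschitz with constant \<open>L = \<parallel>J\<parallel>\<^sub>1 + 1\<close>. In the norm
  \<open>sup\<^sub>t e\<^bsup>-2Lt\<^esup> \<parallel>u t\<parallel>\<close> the Picard map contracts by the factor \<open>1/2\<close>, which gives a solution for
  all times at once; the same weight, on a bounded time interval, gives uniqueness among all
  continuous solutions, however fast they grow.\<close>

section \<open>Representatives and completeness of \<open>'a L1\<close>\<close>

lemma L1_cases:
  obtains f :: "'a::euclidean_space \<Rightarrow> real" where "integrable lebesgue f" "F = abs_L1 f"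
proof
  show "integrable lebesgue (rep_L1 F)"
    using Quotient3_rep_reflp[OF Quotient3_L1, of F] by (simp add: L1_rel_def)
  show "F = abs_L1 (rep_L1 F)"
    by (simp add: Quotient3_abs_rep[OF Quotient3_L1])
qed

lemma norm_abs_L1:
  fixes f :: "'a::euclidean_space \<Rightarrow> real"
  assumes "integrable lebesgue f"
  shows "norm (abs_L1 f) = (\<integral>x. \<bar>f x\<bar> \<partial>lebesgue)"
  using assms by (intro norm_L1.abs_eq) (simp add: L1_rel_def)

lemma diff_abs_L1:
  fixes f g :: "'a::euclidean_space \<Rightarrow> real"
  assumes "integrable lebesgue f" "integrable lebesgue g"
  shows "abs_L1 f - abs_L1 g = abs_L1 (\<lambda>x. f x - g x)"
  using assms by (intro minus_L1.abs_eq) (simp_all add: L1_rel_def)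

lemma sum_abs_L1:
  fixes f :: "nat \<Rightarrow> 'a::euclidean_space \<Rightarrow> real"
  assumes "\<And>i. integrable lebesgue (f i)"
  shows "(\<Sum>i<n. abs_L1 (f i)) = abs_L1 (\<lambda>x. \<Sum>i<n. f i x)"
proof (induction n)
  case 0
  show ?case by (simp add: zero_L1.abs_eq)
next
  case (Suc n)
  show ?case
    using assms by (simp add: Suc, subst plus_L1.abs_eq) (auto simp: L1_rel_def)
qed

text \<open>The Riesz-Fischer argument. Exchanging sum and integral shows that the series of
  absolute values has a finite integral, hence converges almost everywhere; the pointwise sum of the
  representatives is then integrable, and dominated convergence turns pointwise convergence of the
  partial sums into convergence in norm.\<close>

lemma L1_summable:
  fixes F :: "nat \<Rightarrow> 'a::euclidean_space L1"
  assumes "summable (\<lambda>n. norm (F n))"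
  shows "summable F"
proof -
  have "\<exists>f. \<forall>n. integrable lebesgue (f n) \<and> F n = abs_L1 (f n)"
    by (rule choice) (metis L1_cases)
  then obtain f where f[measurable]: "\<And>n. integrable lebesgue (f n)" and F: "\<And>n. F n = abs_L1 (f n)"
    by blast
  have sums: "summable (\<lambda>n. \<integral>x. norm (f n x) \<partial>lebesgue)"
    using assms by (simp add: F norm_abs_L1 f)
  have "(\<integral>\<^sup>+x. (\<Sum>n. ennreal (norm (f n x))) \<partial>lebesgue) = (\<Sum>n. \<integral>\<^sup>+x. ennreal (norm (f n x)) \<partial>lebesgue)"
    by (rule nn_integral_suminf) (use f in measurable)
  also have "\<dots> = (\<Sum>n. ennreal (\<integral>x. norm (f n x) \<partial>lebesgue))"
    using f by (intro suminf_cong nn_integral_eq_integral) auto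
  also have "\<dots> \<noteq> \<infinity>"
    using sums by (simp add: ennreal_suminf_neq_top)
  finally have "AE x in lebesgue. (\<Sum>n. ennreal (norm (f n x))) \<noteq> \<infinity>"
    by (intro nn_integral_PInf_AE) (use f in measurable)
  then have ae: "AE x in lebesgue. summable (\<lambda>n. norm (f n x))"
    by eventually_elim (rule summable_suminf_not_top, auto)
  let ?S = "\<lambda>x. \<Sum>n. f n x"
  have S: "integrable lebesgue ?S"
    using f ae sums by (rule integrable_suminf)
  have W: "integrable lebesgue (\<lambda>x. \<Sum>n. norm (f n x))"
    using f ae sums by (intro integrable_suminf) auto
  have "(\<lambda>n. \<integral>x. \<bar>?S x - (\<Sum>i<n. f i x)\<bar> \<partial>lebesgue) \<longlonglongrightarrow> (\<integral>x. 0 \<partial>(lebesgue :: 'a measure))"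
  proof (rule integral_dominated_convergence)
    show "(\<lambda>x. \<bar>?S x - (\<Sum>i<n. f i x)\<bar>) \<in> borel_measurable lebesgue" for n
      using S f by measurable
    \<comment> \<open>The sum of absolute values occurs twice in the dominating function: once to
      bound the limit and once to bound the partial sum.\<close>
    show "integrable lebesgue (\<lambda>x. (\<Sum>n. norm (f n x)) + (\<Sum>n. norm (f n x)))"
      using W by simp
    show "AE x in lebesgue. (\<lambda>n. \<bar>?S x - (\<Sum>i<n. f i x)\<bar>) \<longlonglongrightarrow> 0"
      using ae
    proof eventually_elim
      case (elim x)
      have "(\<lambda>n. \<Sum>i<n. f i x) \<longlonglongrightarrow> ?S x"
        by (rule summable_LIMSEQ[OF summable_norm_cancel[OF elim]])
      from tendsto_rabs[OF tendsto_diff[OF tendsto_const[of "?S x"] this]] show ?case by simp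
    qed
    show "AE x in lebesgue. norm \<bar>?S x - (\<Sum>i<n. f i x)\<bar> \<le> (\<Sum>n. norm (f n x)) + (\<Sum>n. norm (f n x))" for n
      using ae
    proof eventually_elim
      case (elim x)
      have "\<bar>?S x\<bar> \<le> (\<Sum>n. norm (f n x))"
        using summable_norm[OF elim] by simp
      moreover have "\<bar>\<Sum>i<n. f i x\<bar> \<le> (\<Sum>i<n. norm (f i x))"
        using norm_sum[of "\<lambda>i. f i x" "{..<n}"] by simp
      moreover have "(\<Sum>i<n. norm (f i x)) \<le> (\<Sum>n. norm (f n x))"
        by (rule sum_le_suminf[OF elim]) auto
      ultimately show ?case unfolding real_norm_def abs_abs by linarith
    qed
  qed simp
  then have "(\<lambda>n. norm (abs_L1 ?S - (\<Sum>i<n. F i))) \<longlonglongrightarrow> 0"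
    using S f by (simp add: F sum_abs_L1 diff_abs_L1 norm_abs_L1)
  then have "(\<lambda>n. \<Sum>i<n. F i) \<longlonglongrightarrow> abs_L1 ?S"
    by (simp add: tendsto_iff dist_norm norm_minus_commute)
  then show ?thesis
    by (auto simp: summable_def sums_def)
qed

text \<open>Along a subsequence with geometrically small increments, a Cauchy sequence is a
  telescoping series that converges absolutely, so \<open>L1_summable\<close> gives a limit of the
  subsequence. By the Cauchy property the whole sequence converges to that limit.\<close>

instance L1 :: (euclidean_space) banach
proof
  fix X :: "nat \<Rightarrow> 'a L1"
  assume X: "Cauchy X"
  have "\<exists>N. \<forall>m\<ge>N. \<forall>n\<ge>N. norm (X m - X n) < (1/2)^k" for k
    using CauchyD[OF X, of "(1/2)^k"] by simp
  then obtain N where N: "\<And>k m n. m \<ge> N k \<Longrightarrow> n \<ge> N k \<Longrightarrow> norm (X m - X n) < (1/2)^k"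
    by metis
  \<comment> \<open>The sum makes \<open>r k\<close> at least \<open>N k\<close>, and the summand
    \<open>k\<close> makes \<open>r\<close> strictly increasing even where \<open>N\<close>
    vanishes.\<close>
  define r where "r k = (\<Sum>i\<le>k. N i) + k" for k
  have r: "strict_mono r"
    by (auto simp: strict_mono_Suc_iff r_def)
  have rN: "r k \<ge> N k" for k
    using member_le_sum[of k "{..k}" N] by (simp add: r_def)
  have "summable (\<lambda>k. norm (X (r (Suc k)) - X (r k)))"
  proof (rule summable_comparison_test')
    show "summable (\<lambda>k. (1/2::real)^k)"
      by (simp add: summable_geometric)
    fix k :: nat
    have "N k \<le> r (Suc k)"
      using rN[of k] strict_mono_less[OF r, of k "Suc k"] by simp
    then show "norm (norm (X (r (Suc k)) - X (r k))) \<le> (1/2)^k"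
      using N[OF _ rN, of k "r (Suc k)"] by simp
  qed
  then have "summable (\<lambda>k. X (r (Suc k)) - X (r k))"
    by (rule L1_summable)
  then obtain l where "(\<lambda>n. \<Sum>k<n. X (r (Suc k)) - X (r k)) \<longlonglongrightarrow> l"
    by (auto simp: summable_def sums_def)
  then have "(\<lambda>n. X (r n) - X (r 0)) \<longlonglongrightarrow> l"
    by (simp add: sum_lessThan_telescope[of "\<lambda>k. X (r k)"])
  from tendsto_add[OF this tendsto_const[of "X (r 0)"]]
  have "(X \<circ> r) \<longlonglongrightarrow> l + X (r 0)"
    by (simp add: o_def)
  with X r show "convergent X"
    using Cauchy_converges_subseq convergentI by blast
qed

section \<open>Lipschitz bounds for \<open>excess\<close> and for convolution with
  \<open>J\<close>\<close>

lemma norm_excess_diff_le: "norm (excess u - excess w) \<le> norm (u - w)"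
proof transfer
  fix u w :: "'a \<Rightarrow> real"
  assume "L1_rel u u" "L1_rel w w"
  then have uw: "integrable lebesgue (\<lambda>x. \<bar>u x - w x\<bar>)"
    and [measurable]: "u \<in> borel_measurable lebesgue" "w \<in> borel_measurable lebesgue"
    by (auto simp: L1_rel_def)
  have "integrable lebesgue (\<lambda>x. \<bar>max (u x - 1) 0 - max (w x - 1) 0\<bar>)"
    by (rule Bochner_Integration.integrable_bound[OF uw]) auto
  then show "(\<integral>x. \<bar>max (u x - 1) 0 - max (w x - 1) 0\<bar> \<partial>lebesgue) \<le> (\<integral>x. \<bar>u x - w x\<bar> \<partial>lebesgue)"
    using uw by (rule integral_mono) auto
qed

lemma integrable_compact_support:
  fixes J :: "'a::euclidean_space \<Rightarrow> real"
  assumes "continuous_on UNIV J" "compact (closure {x. J x \<noteq> 0})"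
  shows "integrable lborel J"
proof -
  have "integrable lborel (\<lambda>x. indicator (closure {x. J x \<noteq> 0}) x *\<^sub>R J x)"
    using assms by (intro borel_integrable_compact) (auto intro: continuous_on_subset)
  moreover have "(\<lambda>x. indicator (closure {x. J x \<noteq> 0}) x *\<^sub>R J x) = J"
    using closure_subset[of "{x. J x \<noteq> 0}"] by (auto simp: indicator_def fun_eq_iff)
  ultimately show ?thesis by simp
qed

lemma bounded_compact_support:
  fixes J :: "'a::euclidean_space \<Rightarrow> real"
  assumes "continuous_on UNIV J" "compact (closure {x. J x \<noteq> 0})"
  obtains B where "\<And>x. \<bar>J x\<bar> \<le> B"
proof -
  have "bounded (J ` closure {x. J x \<noteq> 0})"
    using assms by (intro compact_imp_bounded compact_continuous_image) (auto intro: continuous_on_subset)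
  then obtain B where B: "\<And>x. x \<in> closure {x. J x \<noteq> 0} \<Longrightarrow> \<bar>J x\<bar> \<le> B"
    by (auto simp: bounded_iff)
  have "\<bar>J x\<bar> \<le> max B 0" for x
    using B[of x] closure_subset[of "{x. J x \<noteq> 0}"] by (cases "J x = 0") (auto simp: le_max_iff_disj)
  then show ?thesis by (rule that)
qed

text \<open>As \<open>J\<close> is bounded, the integrand is integrable for every \<open>x\<close>,
  so linearity of the integral applies at each point and the two sides agree as functions, not
  merely almost everywhere.\<close>

lemma convolution_diff:
  fixes J g h :: "'a::euclidean_space \<Rightarrow> real"
  assumes J: "continuous_on UNIV J" "compact (closure {x. J x \<noteq> 0})"
    and g: "integrable lebesgue g" and h: "integrable lebesgue h"
  shows "convolution J (\<lambda>x. g x - h x) = (\<lambda>x. convolution J g x - convolution J h x)"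
proof
  fix x
  have Jm[measurable]: "J \<in> borel_measurable borel"
    using J(1) by (rule borel_measurable_continuous_onI)
  obtain B where B: "\<And>x. \<bar>J x\<bar> \<le> B"
    using bounded_compact_support[OF J] by blast
  have Jx: "(\<lambda>y. J (x - y)) \<in> borel_measurable lebesgue"
    by (rule measurable_completion) measurable
  have I: "integrable lebesgue (\<lambda>y. J (x - y) * k y)" if k: "integrable lebesgue k" for k
  proof (rule Bochner_Integration.integrable_bound)
    show "integrable lebesgue (\<lambda>y. B * k y)"
      using k by simp
    show "(\<lambda>y. J (x - y) * k y) \<in> borel_measurable lebesgue"
      using Jx k by (intro borel_measurable_times) auto
    show "AE y in lebesgue. norm (J (x - y) * k y) \<le> norm (B * k y)"
    proof (rule AE_I2)
      fix y
      have "\<bar>J (x - y)\<bar> \<le> \<bar>B\<bar>" using B[of "x - y"] by simp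
      then show "norm (J (x - y) * k y) \<le> norm (B * k y)"
        by (simp add: abs_mult mult_right_mono)
    qed
  qed
  show "convolution J (\<lambda>x. g x - h x) x = convolution J g x - convolution J h x"
    unfolding convolution_def using I[OF g] I[OF h] by (simp add: right_diff_distrib)
qed

text \<open>Young's inequality for the exponent 1: move the absolute value inside, exchange the
  integrals and use translation invariance. The computation runs in nonnegative extended integrals,
  where the exchange needs only measurability.\<close>

lemma integral_abs_convolution_le:
  fixes J g :: "'a::euclidean_space \<Rightarrow> real"
  assumes J: "continuous_on UNIV J" "compact (closure {x. J x \<noteq> 0})"
    and g: "integrable lebesgue g"
  shows "(\<integral>x. \<bar>convolution J g x\<bar> \<partial>lebesgue) \<le> (\<integral>x. \<bar>J x\<bar> \<partial>lborel) * (\<integral>x. \<bar>g x\<bar> \<partial>lebesgue)"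
proof -
  have Jm[measurable]: "J \<in> borel_measurable borel"
    using J(1) by (rule borel_measurable_continuous_onI)
  have Ji: "integrable lborel J"
    using J by (rule integrable_compact_support)
  have gm: "g \<in> borel_measurable lebesgue"
    using g by auto
  \<comment> \<open>The exchange of integrals takes place on \<open>lborel\<close> times
    \<open>lborel\<close>, so \<open>g\<close> is replaced by a Borel function equal to it almost
    everywhere.\<close>
  obtain b where bm[measurable]: "b \<in> borel_measurable lborel" and gb: "AE x in lborel. g x = b x"
    using completion_ex_borel_measurable_real[OF gm] by blast
  have conv: "integrable lebesgue (convolution J g)"
    using L1_rel_convolution[OF J, of g g] g by (simp add: L1_rel_def)
  have shift: "(\<integral>\<^sup>+x. ennreal \<bar>J (x - y)\<bar> \<partial>lborel) = ennreal (\<integral>x. \<bar>J x\<bar> \<partial>lborel)" for y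
  proof -
    have "(\<integral>\<^sup>+x. ennreal \<bar>J (x - y)\<bar> \<partial>lborel) = (\<integral>\<^sup>+x. ennreal \<bar>J x\<bar> \<partial>distr lborel borel ((+) (- y)))"
      by (subst nn_integral_distr) auto
    then show ?thesis
      using Ji by (simp add: lborel_distr_plus nn_integral_eq_integral)
  qed
  have "ennreal (\<integral>x. \<bar>convolution J g x\<bar> \<partial>lebesgue) = (\<integral>\<^sup>+x. ennreal \<bar>convolution J g x\<bar> \<partial>lborel)"
    using conv by (subst nn_integral_eq_integral[symmetric]) (auto simp: nn_integral_completion)
  also have "\<dots> \<le> (\<integral>\<^sup>+x. \<integral>\<^sup>+y. ennreal (\<bar>J (x - y)\<bar> * \<bar>b y\<bar>) \<partial>lborel \<partial>lborel)"
  proof (rule nn_integral_mono)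
    fix x
    \<comment> \<open>If the integrand is not integrable, the convolution has the default value 0
      and the bound is trivial.\<close>
    have "ennreal \<bar>convolution J g x\<bar> \<le> (\<integral>\<^sup>+y. ennreal (norm (J (x - y) * g y)) \<partial>lebesgue)"
      unfolding convolution_def
      using integral_norm_bound_ennreal[of lebesgue "\<lambda>y. J (x - y) * g y"]
      by (cases "integrable lebesgue (\<lambda>y. J (x - y) * g y)") (auto simp: not_integrable_integral_eq)
    also have "\<dots> = (\<integral>\<^sup>+y. ennreal (\<bar>J (x - y)\<bar> * \<bar>b y\<bar>) \<partial>lborel)"
      unfolding nn_integral_completion
      by (rule nn_integral_cong_AE) (use gb in eventually_elim, simp add: abs_mult)
    finally show "ennreal \<bar>convolution J g x\<bar> \<le> (\<integral>\<^sup>+y. ennreal (\<bar>J (x - y)\<bar> * \<bar>b y\<bar>) \<partial>lborel)" .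
  qed
  also have "\<dots> = (\<integral>\<^sup>+y. \<integral>\<^sup>+x. ennreal (\<bar>J (x - y)\<bar> * \<bar>b y\<bar>) \<partial>lborel \<partial>lborel)"
    by (rule lborel_pair.Fubini') measurable
  also have "\<dots> = (\<integral>\<^sup>+y. ennreal (\<integral>x. \<bar>J x\<bar> \<partial>lborel) * ennreal \<bar>b y\<bar> \<partial>lborel)"
    by (intro nn_integral_cong) (simp add: ennreal_mult' nn_integral_multc shift)
  also have "\<dots> = ennreal (\<integral>x. \<bar>J x\<bar> \<partial>lborel) * (\<integral>\<^sup>+y. ennreal \<bar>b y\<bar> \<partial>lborel)"
    by (rule nn_integral_cmult) measurable
  also have "(\<integral>\<^sup>+y. ennreal \<bar>b y\<bar> \<partial>lborel) = (\<integral>\<^sup>+y. ennreal \<bar>g y\<bar> \<partial>lebesgue)"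
    unfolding nn_integral_completion by (rule nn_integral_cong_AE) (use gb in auto)
  also have "\<dots> = ennreal (\<integral>x. \<bar>g x\<bar> \<partial>lebesgue)"
    using g by (intro nn_integral_eq_integral) auto
  finally show ?thesis
    by (simp add: ennreal_mult'[symmetric] ennreal_le_iff)
qed

text \<open>By linearity this is Young's inequality for the difference. \<open>L1_conv\<close> works
  on an arbitrary representative, so explicit ones are fixed first and \<open>L1_conv_abs_L1\<close>
  carries the convolution over to them.\<close>

lemma norm_L1_conv_diff_le:
  fixes J :: "'a::euclidean_space \<Rightarrow> real"
  assumes J: "continuous_on UNIV J" "compact (closure {x. J x \<noteq> 0})"
  shows "norm (L1_conv J u - L1_conv J w) \<le> (\<integral>x. \<bar>J x\<bar> \<partial>lborel) * norm (u - w)"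
proof -
  obtain g h where g: "integrable lebesgue g" "u = abs_L1 g" and h: "integrable lebesgue h" "w = abs_L1 h"
    by (metis L1_cases)
  have conv: "integrable lebesgue (convolution J k)" if "integrable lebesgue k" for k
    using L1_rel_convolution[OF J, of k k] that by (simp add: L1_rel_def)
  have gh: "integrable lebesgue (\<lambda>x. g x - h x)"
    using g h by simp
  have "L1_conv J u - L1_conv J w = abs_L1 (convolution J (\<lambda>x. g x - h x))"
    using g h by (simp add: L1_conv_abs_L1[OF J] diff_abs_L1 conv convolution_diff[OF J])
  then have "norm (L1_conv J u - L1_conv J w) = (\<integral>x. \<bar>convolution J (\<lambda>x. g x - h x) x\<bar> \<partial>lebesgue)"
    by (simp add: norm_abs_L1 conv gh)
  also have "\<dots> \<le> (\<integral>x. \<bar>J x\<bar> \<partial>lborel) * (\<integral>x. \<bar>g x - h x\<bar> \<partial>lebesgue)"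
    by (rule integral_abs_convolution_le[OF J gh])
  also have "(\<integral>x. \<bar>g x - h x\<bar> \<partial>lebesgue) = norm (u - w)"
    using g h gh by (simp add: diff_abs_L1 norm_abs_L1)
  finally show ?thesis .
qed

section \<open>Ordinary differential equations with Lipschitz right-hand side in a Banach
  space\<close>

lemma has_integral_exp_linear:
  fixes K M t :: real
  assumes "K \<noteq> 0" "0 \<le> t"
  shows "((\<lambda>s. M * exp (K * s)) has_integral M / K * (exp (K * t) - 1)) {0..t}"
proof -
  have "((\<lambda>s. M * exp (K * s)) has_integral M / K * exp (K * t) - M / K * exp (K * 0)) {0..t}"
    using assms
    by (intro fundamental_theorem_of_calculus)
       (auto intro!: derivative_eq_intros simp: has_real_derivative_iff_has_vector_derivative[symmetric])
  then show ?thesis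
    by (simp add: algebra_simps)
qed

text \<open>Integration in time preserves growth of order \<open>exp (K * t)\<close> and gains the
  factor \<open>1 / K\<close>, uniformly in \<open>t\<close>. This gain drives both existence and
  uniqueness: a large \<open>K\<close> beats any Lipschitz constant.\<close>

lemma norm_has_integral_exp_bound:
  fixes g :: "real \<Rightarrow> 'b::banach"
  assumes g: "(g has_integral I) {0..t}"
    and K: "0 < K" and t: "0 \<le> t" and M: "0 \<le> M"
    and le: "\<And>s. 0 \<le> s \<Longrightarrow> s \<le> t \<Longrightarrow> norm (g s) \<le> M * exp (K * s)"
  shows "norm I \<le> M / K * exp (K * t)"
proof -
  have e: "((\<lambda>s. M * exp (K * s)) has_integral M / K * (exp (K * t) - 1)) {0..t}"
    using K t by (intro has_integral_exp_linear) auto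
  have "norm (integral {0..t} g) \<le> integral {0..t} (\<lambda>s. M * exp (K * s))"
    using g e le by (intro integral_norm_bound_integral) (auto simp: has_integral_integrable)
  also have "\<dots> = M / K * (exp (K * t) - 1)"
    using e by (rule integral_unique)
  also have "\<dots> \<le> M / K * exp (K * t)"
    using K M by (intro mult_left_mono) auto
  finally show ?thesis
    using integral_unique[OF g] by simp
qed

text \<open>The Picard map acts on \<open>w t = e\<^bsup>-Kt\<^esup> u t\<close> and is extended constantly to negative times,
  because the type of bounded continuous functions has no restricted domain.\<close>

lemma lipschitz_flow_exists:
  fixes G :: "'b::banach \<Rightarrow> 'b"
  assumes L: "0 < L" and lip: "\<And>x y. norm (G x - G y) \<le> L * norm (x - y)"
  shows "\<exists>u::real \<Rightarrow> 'b. continuous_on UNIV u \<and> u 0 = f \<and>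
    (\<forall>t\<ge>0. ((\<lambda>s. G (u s)) has_integral (u t - f)) {0..t})"
proof -
  \<comment> \<open>With this choice the gain \<open>1 / K\<close> turns the Lipschitz constant
    \<open>L\<close> into the contraction factor 1/2.\<close>
  define K where "K = 2 * L"
  have K: "0 < K" using L by (simp add: K_def)
  have Gc: "continuous_on UNIV G"
  proof -
    have "L-lipschitz_on UNIV G"
      using L lip by (auto intro!: lipschitz_onI simp: dist_norm)
    then show ?thesis by (rule lipschitz_on_continuous_on)
  qed
  define g where "g w s = G (exp (K * s) *\<^sub>R apply_bcontfun w s)" for w :: "real \<Rightarrow>\<^sub>C 'b" and s
  define T where "T w t = exp (- (K * max t 0)) *\<^sub>R (f + integral {0..max t 0} (g w))" for w t
  have gc: "continuous_on A (g w)" for w A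
    unfolding g_def
    by (rule continuous_on_compose2[OF Gc]) (auto intro!: continuous_intros)
  have gi: "(g w has_integral integral {0..t} (g w)) {0..t}" for w t
    by (rule integrable_integral[OF integrable_continuous_real[OF gc]])
  have Tc: "continuous_on UNIV (T w)" for w
  proof -
    \<comment> \<open>The indefinite integral is known to be continuous on compact intervals only.
      The right end \<open>x + 1\<close> puts \<open>x\<close> in the interior of the half-line on
      which the composition with \<open>max t 0\<close> is continuous.\<close>
    have "isCont (\<lambda>t. integral {0..max t 0} (g w)) x" for x
    proof -
      have "continuous_on {0..max (x + 1) 0} (\<lambda>t. integral {0..t} (g w))"
        by (rule indefinite_integral_continuous_1[OF integrable_continuous_real[OF gc]])
      then have "continuous_on {..x + 1} (\<lambda>t. integral {0..max t 0} (g w))"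
        by (rule continuous_on_compose2) (auto intro!: continuous_intros)
      then show ?thesis
        by (rule continuous_on_interior) (simp add: interior_real_atMost)
    qed
    then have "continuous_on UNIV (\<lambda>t. integral {0..max t 0} (g w))"
      by (simp add: continuous_on_eq_continuous_at)
    then show ?thesis
      unfolding T_def by (intro continuous_intros)
  qed
  have Tb: "bounded (range (T w))" for w
  proof -
    obtain B where B: "\<And>s. norm (apply_bcontfun w s) \<le> B"
      using bounded_apply_bcontfun[of w] by (auto simp: bounded_iff)
    have B0: "0 \<le> B" using B[of 0] norm_ge_zero order_trans by blast
    \<comment> \<open>The Lipschitz condition gives linear growth, with \<open>norm (G 0)\<close> as
      the constant term; since \<open>exp (K * s)\<close> is at least 1 for nonnegative
      \<open>s\<close>, that term is absorbed into the exponential as well.\<close>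
    let ?M = "L * B + norm (G 0)"
    have "norm (T w t) \<le> norm f + ?M / K" for t
    proof -
      let ?t = "max t 0"
      have "norm (integral {0..?t} (g w)) \<le> ?M / K * exp (K * ?t)"
      proof (rule norm_has_integral_exp_bound[OF gi K])
        show "0 \<le> ?M" using L B0 by simp
        fix s :: real assume "0 \<le> s"
        have "norm (g w s) \<le> norm (G (exp (K * s) *\<^sub>R apply_bcontfun w s) - G 0) + norm (G 0)"
          unfolding g_def using norm_triangle_ineq[of "G (exp (K * s) *\<^sub>R apply_bcontfun w s) - G 0" "G 0"] by simp
        also have "\<dots> \<le> L * (exp (K * s) * B) + norm (G 0) * exp (K * s)"
        proof (rule add_mono)
          have "norm (G (exp (K * s) *\<^sub>R apply_bcontfun w s) - G 0) \<le> L * (exp (K * s) * norm (apply_bcontfun w s))"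
            using lip[of "exp (K * s) *\<^sub>R apply_bcontfun w s" 0] by simp
          also have "\<dots> \<le> L * (exp (K * s) * B)"
            using L B by (intro mult_left_mono) auto
          finally show "norm (G (exp (K * s) *\<^sub>R apply_bcontfun w s) - G 0) \<le> L * (exp (K * s) * B)" .
          have "1 \<le> exp (K * s)" using K \<open>0 \<le> s\<close> by simp
          then show "norm (G 0) \<le> norm (G 0) * exp (K * s)"
            using mult_left_mono[of 1 "exp (K * s)" "norm (G 0)"] by simp
        qed
        finally show "norm (g w s) \<le> ?M * exp (K * s)"
          by (simp add: algebra_simps)
      qed simp
      then have "norm (f + integral {0..?t} (g w)) \<le> norm f + ?M / K * exp (K * ?t)"
        using norm_triangle_ineq[of f "integral {0..?t} (g w)"] by linarith
      then have "norm (T w t) \<le> exp (- (K * ?t)) * (norm f + ?M / K * exp (K * ?t))"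
        unfolding T_def by (simp add: mult_left_mono)
      also have "\<dots> = exp (- (K * ?t)) * norm f + ?M / K"
        by (simp add: exp_minus field_simps)
      also have "\<dots> \<le> norm f + ?M / K"
        using K by (simp add: mult_left_le_one_le)
      finally show ?thesis .
    qed
    then show ?thesis by (auto simp: bounded_iff)
  qed
  define TT where "TT w = Bcontfun (T w)" for w
  have TT: "apply_bcontfun (TT w) = T w" for w
    unfolding TT_def by (rule Bcontfun_inverse) (simp add: bcontfun_def Tc Tb)
  \<comment> \<open>The weight inside \<open>g\<close> contributes \<open>exp (K * s)\<close>,
    integration gives \<open>exp (K * t) / K\<close>, and the outer weight of \<open>T\<close>
    cancels the exponential, leaving \<open>L / K\<close>.\<close>
  have "dist (TT v) (TT w) \<le> 1/2 * dist v w" for v w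
  proof (rule dist_bound)
    fix t :: real
    let ?t = "max t 0"
    have "norm (integral {0..?t} (g v) - integral {0..?t} (g w)) \<le> (L * dist v w) / K * exp (K * ?t)"
    proof (rule norm_has_integral_exp_bound[OF has_integral_diff[OF gi gi] K])
      show "0 \<le> L * dist v w" using L by simp
      fix s :: real
      have "norm (g v s - g w s) \<le> L * (exp (K * s) * dist (apply_bcontfun v s) (apply_bcontfun w s))"
        unfolding g_def
        using lip[of "exp (K * s) *\<^sub>R apply_bcontfun v s" "exp (K * s) *\<^sub>R apply_bcontfun w s"]
        by (simp add: dist_norm scaleR_diff_right[symmetric])
      also have "\<dots> \<le> L * (exp (K * s) * dist v w)"
        using L dist_bounded[of v s w] by (intro mult_left_mono) auto
      finally show "norm (g v s - g w s) \<le> L * dist v w * exp (K * s)"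
        by (simp add: mult_ac)
    qed simp
    then have "exp (- (K * ?t)) * norm (integral {0..?t} (g v) - integral {0..?t} (g w))
        \<le> exp (- (K * ?t)) * ((L * dist v w) / K * exp (K * ?t))"
      by (intro mult_left_mono) auto
    also have "\<dots> = 1/2 * dist v w"
      using L by (simp add: exp_minus field_simps K_def)
    also have "exp (- (K * ?t)) * norm (integral {0..?t} (g v) - integral {0..?t} (g w)) = dist (T v t) (T w t)"
      by (simp add: T_def dist_norm scaleR_diff_right[symmetric])
    finally show "dist (apply_bcontfun (TT v) t) (apply_bcontfun (TT w) t) \<le> 1/2 * dist v w"
      by (simp add: TT)
  qed
  then obtain w where "TT w = w"
    using banach_fix_type[of "1/2" TT] by auto
  then have w: "apply_bcontfun w = T w"
    using TT[of w] by simp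
  \<comment> \<open>Removing the weight turns the fixed point equation into the integral equation
    for nonnegative \<open>t\<close>. At negative times \<open>w\<close> equals \<open>f\<close>, so
    \<open>u\<close> is still continuous on the whole line.\<close>
  define u where "u t = exp (K * t) *\<^sub>R apply_bcontfun w t" for t
  have gu: "g w = (\<lambda>s. G (u s))"
    by (simp add: g_def u_def fun_eq_iff)
  have u: "u t = f + integral {0..t} (g w)" if "0 \<le> t" for t
    using that by (simp add: u_def w T_def max_def exp_minus)
  show ?thesis
  proof (intro exI conjI allI impI)
    show "continuous_on UNIV u"
      unfolding u_def by (intro continuous_intros) auto
    show "u 0 = f"
      by (simp add: u)
    show "((\<lambda>s. G (u s)) has_integral (u t - f)) {0..t}" if "0 \<le> t" for t
      using gi[of w t] u[OF that] by (simp add: gu)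
  qed
qed

text \<open>The weighted distance \<open>d\<close> attains its maximum over the compact interval
  from 0 to \<open>t\<close> at some \<open>r\<close>. Inserting this maximum into the integral
  equation at time \<open>r\<close> bounds \<open>d r\<close> by half of itself, so it vanishes.
  Compactness replaces any growth condition on \<open>u\<close> and \<open>w\<close>.\<close>

lemma lipschitz_flow_unique:
  fixes G :: "'b::banach \<Rightarrow> 'b" and u w :: "real \<Rightarrow> 'b"
  assumes L: "0 < L" and lip: "\<And>x y. norm (G x - G y) \<le> L * norm (x - y)"
    and uc: "continuous_on {0..} u"
    and ui: "\<And>t. 0 \<le> t \<Longrightarrow> ((\<lambda>s. G (u s)) has_integral (u t - f)) {0..t}"
    and wc: "continuous_on {0..} w"
    and wi: "\<And>t. 0 \<le> t \<Longrightarrow> ((\<lambda>s. G (w s)) has_integral (w t - f)) {0..t}"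
    and t: "0 \<le> t"
  shows "w t = u t"
proof -
  define K where "K = 2 * L"
  have K: "0 < K" using L by (simp add: K_def)
  define d where "d s = exp (- (K * s)) * norm (w s - u s)" for s
  have "continuous_on {0..t} d"
    unfolding d_def
    by (intro continuous_intros continuous_on_subset[OF uc] continuous_on_subset[OF wc]) auto
  then obtain r where r: "r \<in> {0..t}" and max: "\<And>s. s \<in> {0..t} \<Longrightarrow> d s \<le> d r"
    using continuous_attains_sup[of "{0..t}" d] t by auto
  have r0: "0 \<le> r" using r by simp
  have "((\<lambda>s. G (w s) - G (u s)) has_integral (w r - f - (u r - f))) {0..r}"
    by (rule has_integral_diff[OF wi[OF r0] ui[OF r0]])
  then have "norm (w r - f - (u r - f)) \<le> (L * d r) / K * exp (K * r)"
  proof (rule norm_has_integral_exp_bound[OF _ K r0])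
    show "0 \<le> L * d r" using L by (simp add: d_def)
    \<comment> \<open>Only times up to \<open>r\<close> enter here, and at all of them
      \<open>d s\<close> is at most the maximum \<open>d r\<close>.\<close>
    fix s :: real assume s: "0 \<le> s" "s \<le> r"
    have "norm (G (w s) - G (u s)) \<le> L * norm (w s - u s)"
      by (rule lip)
    also have "\<dots> = L * (d s * exp (K * s))"
      by (simp add: d_def exp_minus)
    also have "\<dots> \<le> L * (d r * exp (K * s))"
      using L max[of s] s r by (intro mult_left_mono mult_right_mono) auto
    finally show "norm (G (w s) - G (u s)) \<le> L * d r * exp (K * s)"
      by (simp add: mult_ac)
  qed
  then have "exp (- (K * r)) * norm (w r - u r) \<le> exp (- (K * r)) * ((L * d r) / K * exp (K * r))"
    by (intro mult_left_mono) auto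
  also have "\<dots> = d r / 2"
    using L by (simp add: exp_minus field_simps K_def)
  finally have "d r \<le> 0"
    unfolding d_def[symmetric] by simp
  then have "d t \<le> 0"
    using max[of t] t by simp
  then show ?thesis
    by (simp add: d_def mult_le_0_iff)
qed

section \<open>The Stefan problem as a Lipschitz flow\<close>

theorem theorem2p2:
  fixes J :: "real ^ 'n \<Rightarrow> real"
    and f :: "(real ^ 'n) L1"
  assumes "continuous_on UNIV J"
    and "compact (closure {x. J x \<noteq> 0})"
    and "\<And>x y. norm x = norm y \<Longrightarrow> J x = J y"
    and "(\<integral>x. J x \<partial>lebesgue) = 1"
  shows "\<exists>u. L1_solution J f u \<and> (\<forall>w. L1_solution J f w \<longrightarrow> (\<forall>t\<ge>0. w t = u t))"
proof -
  define G where "G u = L1_conv J (excess u) - excess u" for u :: "(real ^ 'n) L1"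
  let ?A = "\<integral>x. \<bar>J x\<bar> \<partial>lborel"
  \<comment> \<open>The summand 1 is the Lipschitz constant of the loss term
    \<open>- excess u\<close>; it also makes the total constant positive at once.\<close>
  have A: "0 < ?A + 1"
    by (simp add: add_nonneg_pos)
  have lip: "norm (G u - G w) \<le> (?A + 1) * norm (u - w)" for u w
  proof -
    have "norm (G u - G w) \<le> norm (L1_conv J (excess u) - L1_conv J (excess w)) + norm (excess u - excess w)"
      unfolding G_def
      using norm_triangle_ineq4[of "L1_conv J (excess u) - L1_conv J (excess w)" "excess u - excess w"]
      by (simp add: algebra_simps)
    also have "\<dots> \<le> ?A * norm (excess u - excess w) + norm (excess u - excess w)"
      using norm_L1_conv_diff_le[OF assms(1,2)] by simp
    also have "\<dots> = (?A + 1) * norm (excess u - excess w)"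
      by (simp add: algebra_simps)
    also have "\<dots> \<le> (?A + 1) * norm (u - w)"
      using A norm_excess_diff_le by (intro mult_left_mono) auto
    finally show ?thesis .
  qed
  \<comment> \<open>The definition asks for positive times, the flow lemmas for nonnegative ones. At
    time 0 the integral over a single point is 0, which equals \<open>u 0 - f\<close> by the initial
    condition.\<close>
  have sol: "L1_solution J f u \<longleftrightarrow> continuous_on {0..} u \<and> u 0 = f \<and>
      (\<forall>t\<ge>0. ((\<lambda>s. G (u s)) has_integral (u t - f)) {0..t})" (is "_ \<longleftrightarrow> ?R") for u
  proof
    assume u: "L1_solution J f u"
    have "((\<lambda>s. G (u s)) has_integral (u t - f)) {0..t}" if "0 \<le> t" for t
      using u that has_integral_refl(2)[of "\<lambda>s. G (u s)" 0]
      by (cases "t = 0") (simp_all add: L1_solution_def G_def)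
    with u show ?R
      by (simp add: L1_solution_def)
  qed (simp add: L1_solution_def G_def)
  obtain u :: "real \<Rightarrow> (real ^ 'n) L1" where u: "continuous_on UNIV u \<and> u 0 = f \<and>
      (\<forall>t\<ge>0. ((\<lambda>s. G (u s)) has_integral (u t - f)) {0..t})"
    using lipschitz_flow_exists[OF A lip, of f] by blast
  then have uc: "continuous_on {0..} u"
    using continuous_on_subset by blast
  show ?thesis
  proof (intro exI conjI allI impI)
    show "L1_solution J f u"
      using u uc by (simp add: sol)
    fix w t assume "L1_solution J f w" "0 \<le> (t::real)"
    then show "w t = u t"
      using u by (intro lipschitz_flow_unique[OF A lip uc, where f = f and w = w and t = t]) (simp_all add: sol)
  qed
qed

end
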